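(* Let $m,n$ be positive integers and let $\sigma:[m]\to[n]$ be a random function such that $\sigma(1),\ldots,\sigma(m)$ are independent (not necessarily identically distributed) random variables with values in $[n]$. For $j\in[n]$ let $B_j:=|\sigma^{-1}(j)|$ and let $B_j^{\mathrm{occ}}\in\{0,1\}$ be the indicator of the event $\{B_j\ge 1\}$. Let $\mu^{\mathrm{occ}}$ be the law of $(B_1^{\mathrm{occ}},\ldots,B_n^{\mathrm{occ}})$, viewed as a probability measure on $\mathbb{N}^n$. Then $\mu^{\mathrm{occ}}$ is conditionally negatively associated (CNA).
   Context: Notation: $\mathbb{N}=\{0,1,2,\ldots\}$, $[n]=\{1,\ldots,n\}$; $\mathbb{N}^n$ carries the coordinatewise partial order $\le$; $\mathrm{x}_j$ denotes the $j$-th coordinate of $\mathbf{x}\in\mathbb{N}^n$. An event $\mathcal{A}\subseteq\mathbb{N}^n$ is increasing if $\mathbf{x}\in\mathcal{A}$, $\mathbf{y}\in\mathbb{N}^n$ and $\mathbf{x}\le\mathbf{y}$ imply $\mathbf{y}\in\mathcal{A}$. A coordinate $j\in[n]$ affects $\mathcal{A}$ if there exist $\mathbf{x}\in\mathcal{A}$ and $\mathbf{y}\in\mathbb{N}^n\setminus\mathcal{A}$ with $\mathrm{x}_i=\mathrm{y}_i$ for all $i\in[n]\setminus\{j\}$. Write $\mathcal{A}\perp\mathcal{B}$ if no coordinate affects both $\mathcal{A}$ and $\mathcal{B}$. A probability measure $\mu$ on $\mathbb{N}^n$ is negatively associated (NA) if $\mu(\mathcal{A}\cap\mathcal{B})\le\mu(\mathcal{A})\mu(\mathcal{B})$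 for all increasing events $\mathcal{A},\mathcal{B}\subseteq\mathbb{N}^n$ with $\mathcal{A}\perp\mathcal{B}$. A probability measure $\mu$ on $\mathbb{N}^n$ is conditionally negatively associated (CNA) if for all $a_1,\ldots,a_n\in\mathbb{N}$ and all $S\subseteq[n]$ such that the event $\{\mathrm{x}_i=a_i\text{ for all }i\in S\}$ has positive $\mu$-probability, the conditional measure $\mu(\cdot\mid \mathrm{x}_i=a_i\text{ for all }i\in S)$ is negatively associated. *)

theory Defs
  imports "HOL-Probability.Probability"
begin

text \<open>Vectors with $n$ natural-number coordinates are functions on \<open>{1..n}\<close>, extended by
  \<^term>\<open>undefined\<close> outside, so that equality of vectors is equality of functions.\<close>

definition Nvec :: "nat \<Rightarrow> (nat \<Rightarrow> nat) set" where
  "Nvec n = {1..n} \<rightarrow>\<^sub>E UNIV"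

definition increasing_event :: "nat \<Rightarrow> (nat \<Rightarrow> nat) set \<Rightarrow> bool" where
  "increasing_event n A \<longleftrightarrow>
     A \<subseteq> Nvec n \<and> (\<forall>x\<in>A. \<forall>y\<in>Nvec n. (\<forall>i\<in>{1..n}. x i \<le> y i) \<longrightarrow> y \<in> A)"

definition affects :: "nat \<Rightarrow> nat \<Rightarrow> (nat \<Rightarrow> nat) set \<Rightarrow> bool" where
  "affects n j A \<longleftrightarrow>
     j \<in> {1..n} \<and> (\<exists>x\<in>A. \<exists>y\<in>Nvec n - A. \<forall>i\<in>{1..n} - {j}. x i = y i)"

definition perp_events :: "nat \<Rightarrow> (nat \<Rightarrow> nat) set \<Rightarrow> (nat \<Rightarrow> nat) set \<Rightarrow> bool" where
  "perp_events n A B \<longleftrightarrow> \<not> (\<exists>j. affects n j A \<and> affects n j B)"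

text \<open>Since \<^term>\<open>Nvec n\<close> is countable, all of its subsets are events.\<close>

definition prob_measure_on_Nvec :: "nat \<Rightarrow> (nat \<Rightarrow> nat) measure \<Rightarrow> bool" where
  "prob_measure_on_Nvec n \<mu> \<longleftrightarrow> prob_space \<mu> \<and> sets \<mu> = Pow (Nvec n)"

definition negatively_associated :: "nat \<Rightarrow> (nat \<Rightarrow> nat) measure \<Rightarrow> bool" where
  "negatively_associated n \<mu> \<longleftrightarrow>
     prob_measure_on_Nvec n \<mu> \<and>
     (\<forall>A B. increasing_event n A \<and> increasing_event n B \<and> perp_events n A B \<longrightarrow>
        measure \<mu> (A \<inter> B) \<le> measure \<mu> A * measure \<mu> B)"

text \<open>For an event $E$ of positive probability, \<^term>\<open>uniform_measure \<mu> E\<close> is the conditional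
  measure given $E$; see \<open>emeasure_uniform_measure\<close>.\<close>

definition conditionally_negatively_associated :: "nat \<Rightarrow> (nat \<Rightarrow> nat) measure \<Rightarrow> bool" where
  "conditionally_negatively_associated n \<mu> \<longleftrightarrow>
     prob_measure_on_Nvec n \<mu> \<and>
     (\<forall>a\<in>Nvec n. \<forall>S\<subseteq>{1..n}.
        measure \<mu> {x \<in> Nvec n. \<forall>i\<in>S. x i = a i} > 0 \<longrightarrow>
        negatively_associated n (uniform_measure \<mu> {x \<in> Nvec n. \<forall>i\<in>S. x i = a i}))"

definition bin_count :: "nat \<Rightarrow> (nat \<Rightarrow> 'a \<Rightarrow> nat) \<Rightarrow> nat \<Rightarrow> 'a \<Rightarrow> nat" where
  "bin_count m \<sigma> j \<omega> = card {i \<in> {1..m}. \<sigma> i \<omega> = j}"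

definition bin_occ :: "nat \<Rightarrow> (nat \<Rightarrow> 'a \<Rightarrow> nat) \<Rightarrow> nat \<Rightarrow> 'a \<Rightarrow> nat" where
  "bin_occ m \<sigma> j \<omega> = (if bin_count m \<sigma> j \<omega> \<ge> 1 then 1 else 0)"

definition occ_law :: "'a measure \<Rightarrow> nat \<Rightarrow> nat \<Rightarrow> (nat \<Rightarrow> 'a \<Rightarrow> nat) \<Rightarrow> (nat \<Rightarrow> nat) measure" where
  "occ_law M m n \<sigma> = distr M (count_space (Nvec n)) (\<lambda>\<omega>. \<lambda>j\<in>{1..n}. bin_occ m \<sigma> j \<omega>)"

end

theory Submission imports Defs begin

text \<open>
  Fix the set \<open>S\<close> of bins whose occupancy is prescribed. Expanding over all allocations
  \<open>s : Q \<rightarrow> V\<close> of a set \<open>Q\<close> of balls to a set \<open>V\<close> of bins, every probability in question becomes a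
  weighted sum \<open>wsum V p Q h\<close> of a function \<open>h\<close> of the vector of loads, and the prescription
  becomes a constraint \<open>c l \<in> K l\<close> on each load. The task is to show that, given the constraint,
  increasing functions \<open>F\<close> and \<open>G\<close> of the loads of two disjoint sets of unconstrained bins are
  negatively correlated. Below, \<open>F\<close> depends on the bins in \<open>I\<close> only.

  The argument rests on two facts about one increasing function \<open>F\<close>, proved together by
  induction on the number of balls. First, adding a ball raises the conditional expectation of
  \<open>F\<close> (\<open>likelier_with_more_balls\<close>). Indeed, whichever bin the extra ball enters, the expectation
  does not drop: in a bin of \<open>I\<close> it can only increase \<open>F\<close>; in a bin \<open>t\<close> outside \<open>I\<close> it merely
  relieves the other balls of part of the constraint on \<open>t\<close>. That such relief helps is the
  second fact: the expectation of \<open>F\<close> given that bin \<open>t\<close> receives exactly \<open>d\<close> balls decreases in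
  \<open>d\<close> (\<open>likelier_with_smaller_load\<close>). For the step from \<open>d\<close> to \<open>d + 1\<close>, single out one of the
  \<open>d + 1\<close> balls in \<open>t\<close>: removing it leaves a system with one ball fewer and exactly \<open>d\<close> balls
  in \<open>t\<close>, to which the first fact applies. As a consequence \<open>F\<close> is negatively correlated
  with the load of every bin outside \<open>I\<close>, also under the constraint (\<open>load_covariance_nonpos\<close>).

  The passage to two functions is in the manner of Feder and Mihail. The number of balls is
  fixed, so \<open>F\<close> is nonnegatively correlated with the number of balls that land in \<open>I\<close>, hence with
  the event that ball \<open>i\<close> lands in \<open>I\<close> for at least one \<open>i\<close>. The function \<open>G\<close> is negatively
  correlated with this event for every ball: a ball landing in \<open>I\<close> is lost for \<open>G\<close>, and fewer
  balls make \<open>G\<close> smaller. Conditioning on whether ball \<open>i\<close> lands in \<open>I\<close> stays within the same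
  class of models, since it only changes the distribution of that ball. So negative correlation
  in both conditional models, which holds by induction, gives negative correlation in the
  original one. The induction ends when it is known of each ball whether it lands in \<open>I\<close>: then
  \<open>F\<close> and \<open>G\<close> are conditionally independent.
\<close>

section \<open>Weighted sums over allocations of balls to bins\<close>

definition add_ball :: "'b \<Rightarrow> ('b \<Rightarrow> nat) \<Rightarrow> 'b \<Rightarrow> nat" where
  "add_ball l c = c(l := Suc (c l))"

definition loads :: "'i set \<Rightarrow> ('i \<Rightarrow> 'b) \<Rightarrow> 'b \<Rightarrow> nat" where
  "loads Q s l = card {i \<in> Q. s i = l}"

text \<open>
  If \<open>p i\<close> is the distribution of ball \<open>i\<close>, this is the expectation of \<open>h\<close> of the loads. The weights
  need not sum to one, so that restricting a ball to a set of bins, which stands for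
  conditioning, needs no normalization. For this reason all inequalities between conditional
  expectations are stated with the denominators cleared.
\<close>

definition wsum :: "'b set \<Rightarrow> ('i \<Rightarrow> 'b \<Rightarrow> real) \<Rightarrow> 'i set \<Rightarrow> (('b \<Rightarrow> nat) \<Rightarrow> real) \<Rightarrow> real" where
  "wsum V p Q h = (\<Sum>s\<in>Q \<rightarrow>\<^sub>E V. (\<Prod>i\<in>Q. p i (s i)) * h (loads Q s))"

definition meets :: "'b set \<Rightarrow> ('b \<Rightarrow> nat set) \<Rightarrow> ('b \<Rightarrow> nat) \<Rightarrow> real" where
  "meets V K c = of_bool (\<forall>l\<in>V. c l \<in> K l)"

text \<open>
  The constraints of interest are ``empty'', ``occupied'', ``exactly \<open>d\<close> balls'' and ``no
  constraint''. What they share is that the admitted loads form an interval.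
\<close>

definition gap_free :: "nat set \<Rightarrow> bool" where
  "gap_free K \<longleftrightarrow> (\<forall>a\<in>K. \<forall>b\<in>K. {a..b} \<subseteq> K)"

lemma add_ball_commute: "add_ball l (add_ball t c) = add_ball t (add_ball l c)"
  by (auto simp: add_ball_def)

lemma add_ball_apply: "add_ball l c t = c t + of_bool (t = l)"
  by (auto simp: add_ball_def)

lemma loads_insert:
  assumes "finite Q" "i \<notin> Q"
  shows "loads (insert i Q) (s(i := l)) = add_ball l (loads Q s)"
proof
  fix t
  have "{j \<in> insert i Q. (s(i := l)) j = t} = (if t = l then {i} else {}) \<union> {j \<in> Q. s j = t}"
    using assms by auto
  thus "loads (insert i Q) (s(i := l)) t = add_ball l (loads Q s) t"
    using assms by (auto simp: loads_def add_ball_def)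
qed

lemma loads_le_card: "finite Q \<Longrightarrow> loads Q s t \<le> card Q"
  unfolding loads_def by (intro card_mono) auto

lemma wsum_insert:
  assumes "finite Q" "i \<notin> Q"
  shows "wsum V p (insert i Q) h = (\<Sum>l\<in>V. p i l * wsum V p Q (\<lambda>c. h (add_ball l c)))"
proof -
  have pr: "(\<Prod>j\<in>insert i Q. p j ((s(i := l)) j)) = p i l * (\<Prod>j\<in>Q. p j (s j))" for l s
  proof -
    have "(\<Prod>j\<in>Q. p j ((s(i := l)) j)) = (\<Prod>j\<in>Q. p j (s j))"
      using assms by (intro prod.cong) auto
    thus ?thesis using assms by simp
  qed
  have "wsum V p (insert i Q) h =
      (\<Sum>(l, s)\<in>V \<times> (Q \<rightarrow>\<^sub>E V). (\<Prod>j\<in>insert i Q. p j ((s(i := l)) j)) * h (loads (insert i Q) (s(i := l))))"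
    unfolding wsum_def PiE_insert_eq
    using inj_combinator[OF assms(2), of "\<lambda>_. V"]
    by (subst sum.reindex) (auto simp: case_prod_unfold)
  also have "\<dots> = (\<Sum>l\<in>V. \<Sum>s\<in>Q \<rightarrow>\<^sub>E V. p i l * (\<Prod>j\<in>Q. p j (s j)) * h (add_ball l (loads Q s)))"
    by (simp only: sum.cartesian_product[symmetric] pr loads_insert[OF assms])
  finally show ?thesis
    by (simp add: wsum_def sum_distrib_left mult.assoc)
qed

lemma wsum_remove:
  assumes "finite Q" "i \<in> Q"
  shows "wsum V p Q h = (\<Sum>l\<in>V. p i l * wsum V p (Q - {i}) (\<lambda>c. h (add_ball l c)))"
  using wsum_insert[of "Q - {i}" i V p h] assms by (simp add: insert_absorb)

lemma wsum_empty: "wsum V p {} h = h (\<lambda>_. 0)"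
  by (simp add: wsum_def loads_def)

lemma wsum_add: "wsum V p Q (\<lambda>c. f c + g c) = wsum V p Q f + wsum V p Q g"
  by (simp add: wsum_def sum.distrib distrib_left)

lemma wsum_scale: "wsum V p Q (\<lambda>c. r * f c) = r * wsum V p Q f"
  by (simp add: wsum_def sum_distrib_left mult_ac)

lemma wsum_mono:
  assumes "\<And>i l. l \<in> V \<Longrightarrow> 0 \<le> p i l" "\<And>c. f c \<le> g c"
  shows "wsum V p Q f \<le> wsum V p Q g"
  unfolding wsum_def
  by (intro sum_mono mult_left_mono prod_nonneg ballI assms) (auto simp: PiE_iff)

lemma wsum_nonneg:
  assumes "\<And>i l. l \<in> V \<Longrightarrow> 0 \<le> p i l" "\<And>c. 0 \<le> f c"
  shows "0 \<le> wsum V p Q f"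
  unfolding wsum_def
  by (intro sum_nonneg mult_nonneg_nonneg prod_nonneg ballI assms) (auto simp: PiE_iff)

lemma tendsto_wsum:
  "((\<lambda>e. wsum V (\<lambda>i l. p i l + e) Q h) \<longlongrightarrow> wsum V p Q h) (at_right 0)"
proof -
  have "((\<lambda>e. wsum V (\<lambda>i l. p i l + e) Q h) \<longlongrightarrow> wsum V (\<lambda>i l. p i l + 0) Q h) (at_right 0)"
    unfolding wsum_def by (intro tendsto_intros)
  thus ?thesis by simp
qed

lemma wsum_cong_weights:
  assumes "\<And>i l. i \<in> Q \<Longrightarrow> l \<in> V \<Longrightarrow> p i l = q i l"
  shows "wsum V p Q h = wsum V q Q h"
  unfolding wsum_def
  by (intro sum.cong arg_cong2[where f = "(*)"] prod.cong refl assms) (auto simp: PiE_iff)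

text \<open>
  Counting the balls in bin \<open>t\<close> amounts to singling out one of them.
\<close>

lemma wsum_size_bias:
  assumes "finite V" "finite Q" "t \<in> V"
  shows "wsum V p Q (\<lambda>c. real (c t) * h c) = 
    (\<Sum>i\<in>Q. p i t * wsum V p (Q - {i}) (\<lambda>c. h (add_ball t c)))"
  using assms(2)
proof (induction Q arbitrary: h rule: finite_induct)
  case empty
  thus ?case by (simp add: wsum_empty)
next
  case (insert j Q)
  have "wsum V p (insert j Q) (\<lambda>c. real (c t) * h c) =
    (\<Sum>l\<in>V. p j l * (wsum V p Q (\<lambda>c. real (c t) * h (add_ball l c)) 
      + of_bool (t = l) * wsum V p Q (\<lambda>c. h (add_ball l c))))"
    using insert.hyps
    by (simp add: wsum_insert add_ball_apply wsum_add[symmetric] wsum_scale[symmetric] distrib_right)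
  also have "\<dots> = (\<Sum>l\<in>V. p j l * wsum V p Q (\<lambda>c. real (c t) * h (add_ball l c)))
      + (\<Sum>l\<in>V. if t = l then p j l * wsum V p Q (\<lambda>c. h (add_ball l c)) else 0)"
    unfolding sum.distrib[symmetric] by (intro sum.cong) (auto simp: distrib_left)
  also have "(\<Sum>l\<in>V. if t = l then p j l * wsum V p Q (\<lambda>c. h (add_ball l c)) else 0)
     = p j t * wsum V p Q (\<lambda>c. h (add_ball t c))"
    using assms by simp
  also have "(\<Sum>l\<in>V. p j l * wsum V p Q (\<lambda>c. real (c t) * h (add_ball l c)))
    = (\<Sum>l\<in>V. \<Sum>i\<in>Q. p j l * (p i t * wsum V p (Q - {i}) (\<lambda>c. h (add_ball l (add_ball t c)))))"
    by (simp add: insert.IH sum_distrib_left)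
  also have "\<dots> = (\<Sum>i\<in>Q. \<Sum>l\<in>V. p j l * (p i t * wsum V p (Q - {i}) (\<lambda>c. h (add_ball l (add_ball t c)))))"
    by (rule sum.swap)
  also have "\<dots> = (\<Sum>i\<in>Q. p i t * wsum V p (insert j (Q - {i})) (\<lambda>c. h (add_ball t c)))"
    using insert.hyps
    by (intro sum.cong) (simp_all add: wsum_insert sum_distrib_left mult_ac add_ball_commute)
  also have "\<dots> = (\<Sum>i\<in>Q. p i t * wsum V p (insert j Q - {i}) (\<lambda>c. h (add_ball t c)))"
    using insert.hyps by (intro sum.cong refl arg_cong2[where f="(*)"] arg_cong[where f="\<lambda>Q. wsum V p Q _"]) auto
  finally show ?case using insert.hyps by simp
qed

text \<open>
  Chebyshev's sum inequality in homogeneous form: the ratio \<open>x / w\<close> decreases while \<open>v / u\<close>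
  increases, so weighting by \<open>v\<close> gives \<open>x / w\<close> a smaller mean than weighting by \<open>u\<close>.
\<close>

lemma likelihood_ratio_sum_le:
  fixes x w u v :: "nat \<Rightarrow> real"
  assumes xw: "\<And>a b. a \<le> b \<Longrightarrow> x b * w a \<le> x a * w b"
    and uv: "\<And>a b. a \<le> b \<Longrightarrow> v a * u b \<le> v b * u a"
  shows "(\<Sum>d\<le>N. v d * x d) * (\<Sum>d\<le>N. u d * w d) \<le> (\<Sum>d\<le>N. u d * x d) * (\<Sum>d\<le>N. v d * w d)"
proof -
  let ?S = "\<lambda>f. \<Sum>a\<le>N. \<Sum>b\<le>N. f a b :: real"
  let ?g = "\<lambda>a b. u a * x a * (v b * w b) - v a * x a * (u b * w b)"
  have "0 \<le> (v b * u a - v a * u b) * (x a * w b - x b * w a)" for a b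
  proof (cases "a \<le> b")
    case True
    thus ?thesis using xw[of a b] uv[of a b] by simp
  next
    case False
    thus ?thesis using xw[of b a] uv[of b a] by (intro mult_nonpos_nonpos) auto
  qed
  hence "0 \<le> ?S (\<lambda>a b. (v b * u a - v a * u b) * (x a * w b - x b * w a))"
    by (intro sum_nonneg)
  also have "\<dots> = ?S (\<lambda>a b. ?g a b + ?g b a)"
    by (intro sum.cong refl) algebra
  also have "\<dots> = ?S ?g + ?S (\<lambda>a b. ?g b a)"
    by (simp only: sum.distrib)
  also have "?S (\<lambda>a b. ?g b a) = ?S ?g"
    by (rule sum.swap)
  finally have "0 \<le> ?S ?g" by simp
  thus ?thesis
    by (simp only: sum_product sum_subtractf diff_ge_0_iff_ge)
qed

section \<open>Monotonicity in the balls and in the loads\<close>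

lemma meets_nonneg: "0 \<le> meets V K c"
  by (simp add: meets_def)

text \<open>
  A ball that is known to lie in bin \<open>t\<close> turns the constraint on \<open>t\<close> into a shifted one for the
  remaining balls.
\<close>

lemma meets_add_ball:
  "t \<in> V \<Longrightarrow> meets V K (add_ball t c) = meets V (K(t := {d. Suc d \<in> K t})) c"
  by (auto simp: meets_def add_ball_def of_bool_def)

lemma meets_add_ball_free:
  "K t = UNIV \<Longrightarrow> meets V K (add_ball t c) = meets V K c"
  by (auto simp: meets_def add_ball_def of_bool_def)

lemma meets_split:
  assumes "t \<in> V"
  shows "meets V (K(t := X)) c = of_bool (c t \<in> X) * meets V (K(t := UNIV)) c"
proof -
  have "(\<forall>l\<in>V. c l \<in> (K(t := X)) l) \<longleftrightarrow> c t \<in> X \<and> (\<forall>l\<in>V. c l \<in> (K(t := UNIV)) l)"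
    using assms by fastforce
  thus ?thesis by (simp only: meets_def of_bool_conj)
qed

text \<open>
  Conditioning on the load of bin \<open>t\<close> turns any dependence on it, the constraint on \<open>t\<close>
  included, into a combination of constraints that fix this load exactly.
\<close>

lemma wsum_layers:
  assumes "finite Q" "t \<in> V"
  shows "wsum V p Q (\<lambda>c. g (c t) * (h c * meets V (K(t := UNIV)) c)) =
    (\<Sum>d\<le>card Q. g d * wsum V p Q (\<lambda>c. h c * meets V (K(t := {d})) c))"
proof -
  have *: "g (c t) * (h c * meets V (K(t := UNIV)) c) 
      = (\<Sum>d\<le>card Q. g d * (h c * meets V (K(t := {d})) c))"
    if "c t \<le> card Q" for c
  proof -
    have "(\<Sum>d\<le>card Q. g d * (h c * meets V (K(t := {d})) c))
       = (\<Sum>d\<le>card Q. if c t = d then g d * (h c * meets V (K(t := UNIV)) c) else 0)"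
      by (intro sum.cong refl, subst meets_split[OF assms(2)]) simp
    thus ?thesis using that by simp
  qed
  have "wsum V p Q (\<lambda>c. g (c t) * (h c * meets V (K(t := UNIV)) c)) =
     wsum V p Q (\<lambda>c. \<Sum>d\<le>card Q. g d * (h c * meets V (K(t := {d})) c))"
    unfolding wsum_def using assms by (intro sum.cong refl arg_cong2[where f="(*)"] *) (auto intro: loads_le_card)
  also have "\<dots> = (\<Sum>d\<le>card Q. wsum V p Q (\<lambda>c. g d * (h c * meets V (K(t := {d})) c)))"
    unfolding wsum_def sum_distrib_left by (rule sum.swap)
  finally show ?thesis by (simp add: wsum_scale)
qed

locale increasing_observable =
  fixes V I :: "'b set" and F :: "('b \<Rightarrow> nat) \<Rightarrow> real"
  assumes finite_V: "finite V" and I_V: "I \<subseteq> V" and I_nonempty: "I \<noteq> {}"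
    and F_nonneg: "0 \<le> F c" and F_le_1: "F c \<le> 1"
    and F_mono: "F c \<le> F (add_ball l c)"
    and F_indep: "l \<in> V - I \<Longrightarrow> F (add_ball l c) = F c"
begin

definition admissible :: "('b \<Rightarrow> nat set) \<Rightarrow> bool" where
  "admissible K \<longleftrightarrow> (\<forall>l\<in>I. K l = UNIV) \<and> (\<forall>l. gap_free (K l))"

lemma admissible_upd: "admissible K \<Longrightarrow> t \<notin> I \<Longrightarrow> gap_free X \<Longrightarrow> admissible (K(t := X))"
  by (auto simp: admissible_def)

lemma gap_free_singleton: "gap_free {d}"
  by (auto simp: gap_free_def)

text \<open>
  The premise \<open>more\<close> is the monotonicity in the balls, for the addition of any one of the balls
  of \<open>Q\<close>. Adjacent loads are compared by size bias. Comparing distant loads needs transitivity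
  of the comparison of ratios, which breaks down if a load in between has weight zero. Positive
  weights exclude this: a ball can always be moved from \<open>t\<close> to a bin of \<open>I\<close>, which carries no
  constraint.
\<close>

lemma likelier_with_smaller_load:
  assumes pos: "\<And>i l. l \<in> V \<Longrightarrow> 0 < p i l" and Q: "finite Q"
    and adm: "admissible K" and t: "t \<in> V - I"
    and more: "\<And>i K. i \<in> Q \<Longrightarrow> admissible K \<Longrightarrow>
      wsum V p (Q - {i}) (\<lambda>c. F c * meets V K c) * wsum V p Q (meets V K)
      \<le> wsum V p Q (\<lambda>c. F c * meets V K c) * wsum V p (Q - {i}) (meets V K)"
    and ab: "a \<le> b"
  shows "wsum V p Q (\<lambda>c. F c * meets V (K(t := {b})) c) * wsum V p Q (meets V (K(t := {a})))
    \<le> wsum V p Q (\<lambda>c. F c * meets V (K(t := {a})) c) * wsum V p Q (meets V (K(t := {b})))"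
proof -
  define x where "x = (\<lambda>R d. wsum V p R (\<lambda>c. F c * meets V (K(t := {d})) c))"
  define w where "w = (\<lambda>R d. wsum V p R (meets V (K(t := {d}))))"
  have pn: "\<And>i l. l \<in> V \<Longrightarrow> 0 \<le> p i l" using pos by (simp add: less_imp_le)
  have x0: "0 \<le> x R d" for R d
    unfolding x_def by (intro wsum_nonneg pn mult_nonneg_nonneg F_nonneg meets_nonneg)
  have w0: "0 \<le> w R d" for R d
    unfolding w_def by (intro wsum_nonneg pn meets_nonneg)
  have xw: "x R d \<le> w R d" for R d
    unfolding x_def w_def
    by (intro wsum_mono pn) (auto simp: F_le_1 meets_nonneg mult_left_le_one_le F_nonneg)
  have tV: "t \<in> V" using t by simp
  have shift: "meets V (K(t := {Suc d})) (add_ball t c) = meets V (K(t := {d})) c" for d c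
    using meets_add_ball[OF tV, of "K(t := {Suc d})"] by simp
  have pull: "real (c t) * (h c * meets V (K(t := {d})) c) = real d * (h c * meets V (K(t := {d})) c)" for h c d
    using meets_split[OF tV, of K "{d}" c] by (cases "c t = d") auto
  have bias_x: "real (Suc d) * x Q (Suc d) = (\<Sum>i\<in>Q. p i t * x (Q - {i}) d)" for d
    unfolding x_def wsum_scale[symmetric] pull[where h = F, symmetric]
    by (subst wsum_size_bias[OF finite_V Q tV]) (simp add: shift F_indep[OF t] wsum_scale)
  have bias_w: "real (Suc d) * w Q (Suc d) = (\<Sum>i\<in>Q. p i t * w (Q - {i}) d)" for d
    unfolding w_def wsum_scale[symmetric] pull[where h = "\<lambda>_. 1", unfolded mult_1, symmetric]
    by (subst wsum_size_bias[OF finite_V Q tV]) (simp add: shift wsum_scale)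
  have adjacent: "x Q (Suc d) * w Q d \<le> x Q d * w Q (Suc d)" for d
  proof -
    have "real (Suc d) * (x Q (Suc d) * w Q d) = (\<Sum>i\<in>Q. p i t * (x (Q - {i}) d * w Q d))"
      unfolding mult.assoc[symmetric] bias_x sum_distrib_right ..
    also have "\<dots> \<le> (\<Sum>i\<in>Q. p i t * (x Q d * w (Q - {i}) d))"
      unfolding x_def w_def using adm t
      by (intro sum_mono mult_left_mono more pn admissible_upd gap_free_singleton) auto
    also have "\<dots> = x Q d * (\<Sum>i\<in>Q. p i t * w (Q - {i}) d)"
      by (simp add: sum_distrib_left mult_ac)
    also have "\<dots> = real (Suc d) * (x Q d * w Q (Suc d))"
      by (simp only: bias_w[symmetric] mult_ac)
    finally show ?thesis by (simp del: of_nat_Suc)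
  qed
  have no_gap: "w Q (Suc d) = 0" if "w Q d = 0" for d
  proof -
    obtain l where l: "l \<in> I" using I_nonempty by blast
    have "w (Q - {i}) d = 0" if i: "i \<in> Q" for i
    proof -
      have free: "meets V (K(t := {d})) (add_ball l c) = meets V (K(t := {d})) c" for c
        using l t adm by (intro meets_add_ball_free) (auto simp: admissible_def)
      have "p i l * w (Q - {i}) d = p i l * wsum V p (Q - {i}) (\<lambda>c. meets V (K(t := {d})) (add_ball l c))"
        by (simp add: w_def free)
      also have "\<dots> \<le> w Q d"
        unfolding w_def wsum_remove[OF Q i] using l I_V finite_V
        by (intro member_le_sum mult_nonneg_nonneg wsum_nonneg meets_nonneg pn) auto
      finally show ?thesis using \<open>w Q d = 0\<close> w0[of "Q - {i}" d] pos[of l i] l I_V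
        by (auto simp: mult_le_0_iff)
    qed
    hence "real (Suc d) * w Q (Suc d) = 0" unfolding bias_w by simp
    thus ?thesis by simp
  qed
  from ab have "x Q b * w Q a \<le> x Q a * w Q b"
  proof (induction b rule: dec_induct)
    case base
    show ?case by simp
  next
    case (step d)
    show ?case
    proof (cases "w Q d = 0")
      case True
      hence "w Q (Suc d) = 0" by (rule no_gap)
      hence "x Q (Suc d) = 0" using xw[of Q "Suc d"] x0[of Q "Suc d"] by simp
      thus ?thesis using x0 w0 by simp
    next
      case False
      hence d: "0 < w Q d" using w0[of Q d] by simp
      have "x Q (Suc d) * w Q a * w Q d = (x Q (Suc d) * w Q d) * w Q a" by simp
      also have "\<dots> \<le> (x Q d * w Q (Suc d)) * w Q a"
        by (intro mult_right_mono adjacent w0)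
      also have "\<dots> = (x Q d * w Q a) * w Q (Suc d)" by simp
      also have "\<dots> \<le> (x Q a * w Q d) * w Q (Suc d)"
        by (intro mult_right_mono step.IH w0)
      finally show ?thesis using d by (simp add: mult_ac)
    qed
  qed
  thus ?thesis unfolding x_def w_def .
qed

text \<open>
  The extra ball \<open>i\<close> is placed bin by bin. If it enters a bin \<open>l\<close> outside \<open>I\<close>, the remaining
  balls face the interval \<open>K l\<close> shifted down by one. This favours smaller loads of \<open>l\<close> in the
  sense of likelihood ratios, and smaller loads favour \<open>F\<close>.
\<close>

lemma likelier_with_more_balls_pos:
  assumes pos: "\<And>i l. l \<in> V \<Longrightarrow> 0 < p i l" and Q: "finite Q" "i \<in> Q" and adm: "admissible K"
  shows "wsum V p (Q - {i}) (\<lambda>c. F c * meets V K c) * wsum V p Q (meets V K)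
    \<le> wsum V p Q (\<lambda>c. F c * meets V K c) * wsum V p (Q - {i}) (meets V K)"
  using Q adm
proof (induction "card Q" arbitrary: Q i K rule: less_induct)
  case less
  define R where "R = Q - {i}"
  have R: "finite R" "card R < card Q"
    using less.prems by (simp_all only: R_def finite_Diff card_Diff1_less)
  have pn: "\<And>i l. l \<in> V \<Longrightarrow> 0 \<le> p i l" using pos by (simp add: less_imp_le)
  let ?x = "\<lambda>h. wsum V p R (\<lambda>c. F c * h c)" and ?w = "wsum V p R"
  have bin: "?x (meets V K) * ?w (\<lambda>c. meets V K (add_ball l c))
     \<le> wsum V p R (\<lambda>c. F (add_ball l c) * meets V K (add_ball l c)) * ?w (meets V K)"
    if l: "l \<in> V" for l
  proof (cases "l \<in> I")
    case True
    hence eq: "meets V K (add_ball l c) = meets V K c" for c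
      using less.prems(3) by (intro meets_add_ball_free) (auto simp: admissible_def)
    show ?thesis unfolding eq
      by (intro mult_right_mono wsum_mono wsum_nonneg pn F_mono meets_nonneg)
  next
    case False
    hence l: "l \<in> V - I" using l by simp
    hence lV: "l \<in> V" by simp
    have gf: "gap_free (K l)" using less.prems(3) by (auto simp: admissible_def)
    let ?v = "\<lambda>d. of_bool (d \<in> K l) :: real" and ?u = "\<lambda>d. of_bool (Suc d \<in> K l) :: real"
    have v: "meets V K c = ?v (c l) * meets V (K(l := UNIV)) c" for c
      using meets_split[OF lV, of K "K l" c] by simp
    have u: "meets V K (add_ball l c) = ?u (c l) * meets V (K(l := UNIV)) c" for c
      using meets_split[OF lV, of K "{d. Suc d \<in> K l}" c] by (simp add: meets_add_ball[OF lV])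
    have lay: "wsum V p R (\<lambda>c. h c * (g (c l) * meets V (K(l := UNIV)) c)) =
       (\<Sum>d\<le>card R. g d * wsum V p R (\<lambda>c. h c * meets V (K(l := {d})) c))" for g h
      using wsum_layers[OF R(1) lV, of p g h K] by (simp add: mult_ac)
    note lay1 = lay[of "\<lambda>_. 1", simplified mult_1]
    have "(\<Sum>d\<le>card R. ?v d * ?x (meets V (K(l := {d})))) * (\<Sum>d\<le>card R. ?u d * ?w (meets V (K(l := {d}))))
      \<le> (\<Sum>d\<le>card R. ?u d * ?x (meets V (K(l := {d})))) * (\<Sum>d\<le>card R. ?v d * ?w (meets V (K(l := {d}))))"
    proof (rule likelihood_ratio_sum_le)
      fix a b :: nat assume ab: "a \<le> b"
      show "?x (meets V (K(l := {b}))) * ?w (meets V (K(l := {a})))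
        \<le> ?x (meets V (K(l := {a}))) * ?w (meets V (K(l := {b})))"
        by (rule likelier_with_smaller_load[OF pos R(1) less.prems(3) l less.hyps[OF R(2) R(1)] ab])
      show "?v a * ?u b \<le> ?v b * ?u a"
      proof (cases "a \<in> K l \<and> Suc b \<in> K l")
        case True
        hence "{a..Suc b} \<subseteq> K l" using gf by (auto simp: gap_free_def)
        hence "b \<in> K l" "Suc a \<in> K l" using ab by (auto simp: subset_iff)
        thus ?thesis by simp
      qed auto
    qed
    thus ?thesis
      unfolding F_indep[OF l] u unfolding v lay[where g = ?v] lay[where g = ?u] lay1[where g = ?v] lay1[where g = ?u] .
  qed
  have "wsum V p R (\<lambda>c. F c * meets V K c) * wsum V p Q (meets V K)
    = (\<Sum>l\<in>V. p i l * (?x (meets V K) * ?w (\<lambda>c. meets V K (add_ball l c))))"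
    unfolding wsum_remove[OF less.prems(1,2)] R_def[symmetric]
    by (simp add: sum_distrib_left mult_ac)
  also have "\<dots> \<le> (\<Sum>l\<in>V. p i l * (wsum V p R (\<lambda>c. F (add_ball l c) * meets V K (add_ball l c)) * ?w (meets V K)))"
    by (intro sum_mono mult_left_mono bin pn)
  also have "\<dots> = wsum V p Q (\<lambda>c. F c * meets V K c) * ?w (meets V K)"
    unfolding wsum_remove[OF less.prems(1,2)] R_def[symmetric]
    by (simp add: sum_distrib_left sum_distrib_right mult_ac)
  finally show ?case unfolding R_def .
qed

text \<open>
  Given the load \<open>d\<close> of bin \<open>t\<close>, the expectation of \<open>F\<close> decreases in \<open>d\<close>; Chebyshev's
  inequality compares the law of the load with its size-biased version.
\<close>

lemma load_covariance_nonpos_pos: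
  assumes pos: "\<And>i l. l \<in> V \<Longrightarrow> 0 < p i l" and Q: "finite Q" and adm: "admissible K"
    and t: "t \<in> V - I"
  shows "wsum V p Q (\<lambda>c. real (c t) * (F c * meets V K c)) * wsum V p Q (meets V K)
    \<le> wsum V p Q (\<lambda>c. F c * meets V K c) * wsum V p Q (\<lambda>c. real (c t) * meets V K c)"
proof -
  have tV: "t \<in> V" using t by simp
  let ?x = "\<lambda>h. wsum V p Q (\<lambda>c. F c * h c)" and ?w = "wsum V p Q"
  let ?u = "\<lambda>d. of_bool (d \<in> K t) :: real"
  let ?v = "\<lambda>d. real d * ?u d"
  have u: "meets V K c = ?u (c t) * meets V (K(t := UNIV)) c" for c
    using meets_split[OF tV, of K "K t" c] by simp
  have lay: "wsum V p Q (\<lambda>c. h c * (g (c t) * meets V (K(t := UNIV)) c)) =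
       (\<Sum>d\<le>card Q. g d * wsum V p Q (\<lambda>c. h c * meets V (K(t := {d})) c))" for g h
    using wsum_layers[OF Q tV, of p g h K] by (simp add: mult_ac)
  note lay1 = lay[of "\<lambda>_. 1", simplified mult_1]
  have "(\<Sum>d\<le>card Q. ?v d * ?x (meets V (K(t := {d})))) * (\<Sum>d\<le>card Q. ?u d * ?w (meets V (K(t := {d}))))
      \<le> (\<Sum>d\<le>card Q. ?u d * ?x (meets V (K(t := {d})))) * (\<Sum>d\<le>card Q. ?v d * ?w (meets V (K(t := {d}))))"
  proof (rule likelihood_ratio_sum_le)
    fix a b :: nat assume ab: "a \<le> b"
    show "?x (meets V (K(t := {b}))) * ?w (meets V (K(t := {a})))
        \<le> ?x (meets V (K(t := {a}))) * ?w (meets V (K(t := {b})))"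
      by (rule likelier_with_smaller_load[OF pos Q adm t likelier_with_more_balls_pos[OF pos Q] ab])
    show "?v a * ?u b \<le> ?v b * ?u a" using ab by (simp add: of_bool_def)
  qed
  moreover have "wsum V p Q (\<lambda>c. real (c t) * (F c * meets V K c)) = (\<Sum>d\<le>card Q. ?v d * ?x (meets V (K(t := {d}))))"
    using lay[of F ?v] unfolding u by (simp add: mult_ac)
  moreover have "wsum V p Q (\<lambda>c. real (c t) * meets V K c) = (\<Sum>d\<le>card Q. ?v d * ?w (meets V (K(t := {d}))))"
    using lay1[of ?v] unfolding u by (simp add: mult_ac)
  moreover have "wsum V p Q (\<lambda>c. F c * meets V K c) = (\<Sum>d\<le>card Q. ?u d * ?x (meets V (K(t := {d}))))"
    "wsum V p Q (meets V K) = (\<Sum>d\<le>card Q. ?u d * ?w (meets V (K(t := {d}))))"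
    using lay[of F ?u] lay1[of ?u] unfolding u by simp_all
  ultimately show ?thesis by simp
qed


text \<open>
  This inequality and the next are polynomial in the weights and hence pass to the limit. Zero
  weights are essential later, where a ball is restricted to a set of bins.
\<close>

lemma likelier_with_more_balls:
  assumes p: "\<And>i l. l \<in> V \<Longrightarrow> 0 \<le> p i l" and Q: "finite Q" "i \<in> Q" and adm: "admissible K"
  shows "wsum V p (Q - {i}) (\<lambda>c. F c * meets V K c) * wsum V p Q (meets V K)
    \<le> wsum V p Q (\<lambda>c. F c * meets V K c) * wsum V p (Q - {i}) (meets V K)"
proof (rule tendsto_le[OF trivial_limit_at_right_real])
  show "\<forall>\<^sub>F e in at_right 0.
    wsum V (\<lambda>i l. p i l + e) (Q - {i}) (\<lambda>c. F c * meets V K c) * wsum V (\<lambda>i l. p i l + e) Q (meets V K)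
    \<le> wsum V (\<lambda>i l. p i l + e) Q (\<lambda>c. F c * meets V K c) * wsum V (\<lambda>i l. p i l + e) (Q - {i}) (meets V K)"
    using eventually_at_right_less[of 0]
    by eventually_elim (intro likelier_with_more_balls_pos assms add_nonneg_pos)
qed (intro tendsto_mult tendsto_wsum)+

lemma load_covariance_nonpos:
  assumes p: "\<And>i l. l \<in> V \<Longrightarrow> 0 \<le> p i l" and Q: "finite Q" and adm: "admissible K"
    and t: "t \<in> V - I"
  shows "wsum V p Q (\<lambda>c. real (c t) * (F c * meets V K c)) * wsum V p Q (meets V K)
    \<le> wsum V p Q (\<lambda>c. F c * meets V K c) * wsum V p Q (\<lambda>c. real (c t) * meets V K c)"
proof (rule tendsto_le[OF trivial_limit_at_right_real])
  show "\<forall>\<^sub>F e in at_right 0.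
    wsum V (\<lambda>i l. p i l + e) Q (\<lambda>c. real (c t) * (F c * meets V K c)) * wsum V (\<lambda>i l. p i l + e) Q (meets V K)
    \<le> wsum V (\<lambda>i l. p i l + e) Q (\<lambda>c. F c * meets V K c) * wsum V (\<lambda>i l. p i l + e) Q (\<lambda>c. real (c t) * meets V K c)"
    using eventually_at_right_less[of 0]
    by eventually_elim (intro load_covariance_nonpos_pos assms add_nonneg_pos)
qed (intro tendsto_mult tendsto_wsum)+

end

section \<open>Negative correlation of two increasing functions\<close>

definition restrict_ball :: "('i \<Rightarrow> 'b \<Rightarrow> real) \<Rightarrow> 'i \<Rightarrow> 'b set \<Rightarrow> 'i \<Rightarrow> 'b \<Rightarrow> real" where
  "restrict_ball p i S = p(i := \<lambda>l. if l \<in> S then p i l else 0)"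

lemma wsum_restrict_ball:
  assumes "finite V" "finite Q" "i \<in> Q" "S \<subseteq> V"
  shows "wsum V (restrict_ball p i S) Q h = (\<Sum>l\<in>S. p i l * wsum V p (Q - {i}) (\<lambda>c. h (add_ball l c)))"
proof -
  have "wsum V (restrict_ball p i S) (Q - {i}) = (wsum V p (Q - {i}) :: _ \<Rightarrow> real)"
    by (intro ext wsum_cong_weights) (simp add: restrict_ball_def)
  hence "wsum V (restrict_ball p i S) Q h
      = (\<Sum>l\<in>V. if l \<in> S then p i l * wsum V p (Q - {i}) (\<lambda>c. h (add_ball l c)) else 0)"
    unfolding wsum_remove[OF assms(2,3)] by (intro sum.cong) (auto simp: restrict_ball_def)
  also have "\<dots> = (\<Sum>l\<in>V \<inter> S. p i l * wsum V p (Q - {i}) (\<lambda>c. h (add_ball l c)))"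
    using assms(1) by (simp add: sum.inter_restrict)
  finally show ?thesis using assms(4) by (simp add: Int_absorb1)
qed

lemma wsum_split_ball:
  assumes "finite V" "finite Q" "i \<in> Q" "I \<subseteq> V"
  shows "wsum V p Q h = wsum V (restrict_ball p i I) Q h + wsum V (restrict_ball p i (V - I)) Q h"
  using assms sum.subset_diff[OF assms(4,1), of "\<lambda>l. p i l * wsum V p (Q - {i}) (\<lambda>c. h (add_ball l c))"]
  by (simp add: wsum_restrict_ball wsum_remove[OF assms(2,3), of V p] add.commute)

text \<open>
  Each ball lies in exactly one bin, so the number of balls in \<open>I\<close> is the number of all balls
  minus the loads of the bins outside \<open>I\<close>.
\<close>

lemma sum_wsum_restrict_ball:
  assumes "finite V" "finite Q" "I \<subseteq> V"
  shows "(\<Sum>i\<in>Q. wsum V (restrict_ball p i I) Q h)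
    = real (card Q) * wsum V p Q h - (\<Sum>t\<in>V - I. wsum V p Q (\<lambda>c. real (c t) * h c))"
proof -
  have "(\<Sum>t\<in>V - I. wsum V p Q (\<lambda>c. real (c t) * h c)) = 
    (\<Sum>t\<in>V - I. \<Sum>i\<in>Q. p i t * wsum V p (Q - {i}) (\<lambda>c. h (add_ball t c)))"
    using assms by (intro sum.cong wsum_size_bias) auto
  also have "\<dots> = (\<Sum>i\<in>Q. wsum V (restrict_ball p i (V - I)) Q h)"
    using assms by (subst sum.swap) (simp add: wsum_restrict_ball)
  finally have "(\<Sum>i\<in>Q. wsum V (restrict_ball p i I) Q h) + (\<Sum>t\<in>V - I. wsum V p Q (\<lambda>c. real (c t) * h c))
    = (\<Sum>i\<in>Q. wsum V (restrict_ball p i I) Q h + wsum V (restrict_ball p i (V - I)) Q h)"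
    by (simp add: sum.distrib)
  also have "\<dots> = (\<Sum>i\<in>Q. wsum V p Q h)"
    using assms by (intro sum.cong refl wsum_split_ball[symmetric])
  finally show ?thesis by simp
qed

text \<open>
  If each ball is confined to \<open>I\<close> or to its complement, the loads of these two sets of bins are
  independent. The identity with four functions expresses this without normalization and is
  preserved when a ball is added.
\<close>

lemma wsum_factorizes:
  fixes f f' g g' :: "('b \<Rightarrow> nat) \<Rightarrow> real"
  assumes "finite V" "finite Q" "I \<subseteq> V"
    and "\<And>i. i \<in> Q \<Longrightarrow> (\<forall>l\<in>I. p i l = 0) \<or> (\<forall>l\<in>V - I. p i l = 0)"
    and "\<And>l c. l \<in> V - I \<Longrightarrow> f (add_ball l c) = f c" "\<And>l c. l \<in> V - I \<Longrightarrow> f' (add_ball l c) = f' c"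
    and "\<And>l c. l \<in> I \<Longrightarrow> g (add_ball l c) = g c" "\<And>l c. l \<in> I \<Longrightarrow> g' (add_ball l c) = g' c"
  shows "wsum V p Q (\<lambda>c. f c * g c) * wsum V p Q (\<lambda>c. f' c * g' c)
    = wsum V p Q (\<lambda>c. f c * g' c) * wsum V p Q (\<lambda>c. f' c * g c)"
  using assms(2,4-)
proof (induction Q arbitrary: f f' g g' rule: finite_induct)
  case empty
  show ?case by (simp add: wsum_empty)
next
  case (insert i Q)
  note indep = insert.prems(2-5)
  let ?W = "wsum V p Q"
  note IH = insert.IH[OF insert.prems(1)]
  have still: "h (add_ball l (add_ball k c)) = h (add_ball l c)" if "\<And>c. h (add_ball k c) = h c"
    for h :: "('b \<Rightarrow> nat) \<Rightarrow> real" and l k c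
    by (metis that add_ball_commute)
  have expand: "wsum V p (insert i Q) h = (\<Sum>l\<in>S. p i l * ?W (\<lambda>c. h (add_ball l c)))"
    if "S \<subseteq> V" "\<forall>l\<in>V - S. p i l = 0" for S h
    unfolding wsum_insert[OF insert.hyps(1,2)] using that assms(1)
    by (intro sum.mono_neutral_right) auto
  consider "\<forall>l\<in>V - I. p i l = 0" | "\<forall>l\<in>I. p i l = 0" using insert.prems(1)[of i] by auto
  thus ?case
  proof cases
    case 1
    have "wsum V p (insert i Q) (\<lambda>c. f c * g c) * wsum V p (insert i Q) (\<lambda>c. f' c * g' c)
      = (\<Sum>l\<in>I. \<Sum>k\<in>I. p i l * p i k * (?W (\<lambda>c. f (add_ball l c) * g c) * ?W (\<lambda>c. f' (add_ball k c) * g' c)))"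
      unfolding expand[OF assms(3) 1] sum_product using indep
      by (intro sum.cong) (simp_all add: mult_ac)
    also have "\<dots> = (\<Sum>l\<in>I. \<Sum>k\<in>I. p i l * p i k * (?W (\<lambda>c. f (add_ball l c) * g' c) * ?W (\<lambda>c. f' (add_ball k c) * g c)))"
      by (intro sum.cong refl arg_cong[where f = "times a" for a] IH) (simp_all add: indep still[of f] still[of f'] still[of g] still[of g'])
    also have "\<dots> = wsum V p (insert i Q) (\<lambda>c. f c * g' c) * wsum V p (insert i Q) (\<lambda>c. f' c * g c)"
      unfolding expand[OF assms(3) 1] sum_product using indep
      by (intro sum.cong) (simp_all add: mult_ac)
    finally show ?thesis .
  next
    case 2
    hence 2: "\<forall>l\<in>V - (V - I). p i l = 0" by auto
    have "wsum V p (insert i Q) (\<lambda>c. f c * g c) * wsum V p (insert i Q) (\<lambda>c. f' c * g' c)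
      = (\<Sum>l\<in>V - I. \<Sum>k\<in>V - I. p i l * p i k * (?W (\<lambda>c. f c * g (add_ball l c)) * ?W (\<lambda>c. f' c * g' (add_ball k c))))"
      unfolding expand[OF Diff_subset 2] sum_product using indep
      by (intro sum.cong) (simp_all add: mult_ac)
    also have "\<dots> = (\<Sum>l\<in>V - I. \<Sum>k\<in>V - I. p i l * p i k * (?W (\<lambda>c. f c * g' (add_ball k c)) * ?W (\<lambda>c. f' c * g (add_ball l c))))"
      by (intro sum.cong refl arg_cong[where f = "times a" for a] IH) (simp_all add: indep still[of f] still[of f'] still[of g] still[of g'])
    also have "\<dots> = (\<Sum>k\<in>V - I. \<Sum>l\<in>V - I. p i l * p i k * (?W (\<lambda>c. f c * g' (add_ball k c)) * ?W (\<lambda>c. f' c * g (add_ball l c))))"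
      by (rule sum.swap)
    also have "\<dots> = wsum V p (insert i Q) (\<lambda>c. f c * g' c) * wsum V p (insert i Q) (\<lambda>c. f' c * g c)"
      unfolding expand[OF Diff_subset 2] sum_product using indep
      by (intro sum.cong) (simp_all add: mult_ac)
    finally show ?thesis .
  qed
qed

text \<open>
  A mixture of two models, with total weights \<open>e1\<close> and \<open>e0\<close>, inherits negative correlation from
  its components if the two functions shift in opposite directions from one component to the
  other. For positive \<open>e1\<close> and \<open>e0\<close> the gain is the product of the two differences in
  \<open>between\<close>, divided by \<open>e1 * e0\<close>.
\<close>

lemma mixture_negative_correlation:
  fixes ab1 ab0 a1 a0 b1 b0 e1 e0 :: real
  assumes nonneg: "0 \<le> ab1" "0 \<le> ab0" "0 \<le> a1" "0 \<le> a0" "0 \<le> b1" "0 \<le> b0"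
    and le: "ab1 \<le> e1" "ab0 \<le> e0"
    and within: "ab1 * e1 \<le> a1 * b1" "ab0 * e0 \<le> a0 * b0"
    and between: "a0 * e1 \<le> a1 * e0" "b1 * e0 \<le> b0 * e1"
  shows "(ab1 + ab0) * (e1 + e0) \<le> (a1 + a0) * (b1 + b0)"
proof -
  have e: "0 \<le> e1" "0 \<le> e0" using nonneg le by linarith+
  consider "e1 = 0" | "e0 = 0" | "0 < e1" "0 < e0" using e by linarith
  thus ?thesis
  proof cases
    case 1
    hence "ab1 = 0" using nonneg le by simp
    moreover have "a0 * b0 \<le> (a1 + a0) * (b1 + b0)"
      using nonneg by (intro mult_mono) auto
    ultimately show ?thesis using 1 within by simp
  next
    case 2
    hence "ab0 = 0" using nonneg le by simp
    moreover have "a1 * b1 \<le> (a1 + a0) * (b1 + b0)"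
      using nonneg by (intro mult_mono) auto
    ultimately show ?thesis using 2 within by simp
  next
    case 3
    have "(e1 * e0) * ((ab1 + ab0) * (e1 + e0)) = ((ab1 * e1) * e0 + (ab0 * e0) * e1) * (e1 + e0)"
      by algebra
    also have "\<dots> \<le> ((a1 * b1) * e0 + (a0 * b0) * e1) * (e1 + e0)"
      by (intro mult_right_mono add_mono within) (use e in auto)
    also have "\<dots> = (e1 * e0) * ((a1 + a0) * (b1 + b0)) - (a1 * e0 - a0 * e1) * (b0 * e1 - b1 * e0)"
      by algebra
    also have "\<dots> \<le> (e1 * e0) * ((a1 + a0) * (b1 + b0))"
      using between by simp
    finally show ?thesis using 3 by simp
  qed
qed

text \<open>
  Induction on the number of balls that can land both inside and outside \<open>I\<close>. Restricting such a
  ball to one side decreases this number.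
\<close>

lemma wsum_negatively_associated:
  assumes V: "finite V" "I \<subseteq> V" and Q: "finite Q"
    and p: "\<And>i l. l \<in> V \<Longrightarrow> 0 \<le> p i l"
    and F: "\<And>c. 0 \<le> F c" "\<And>c. F c \<le> 1" "\<And>c l. F c \<le> F (add_ball l c)"
      "\<And>c l. l \<in> V - I \<Longrightarrow> F (add_ball l c) = F c"
    and G: "\<And>c. 0 \<le> G c" "\<And>c. G c \<le> 1" "\<And>c l. G c \<le> G (add_ball l c)"
      "\<And>c l. l \<in> I \<Longrightarrow> G (add_ball l c) = G c"
      "\<And>c l. l \<in> V \<Longrightarrow> K l \<noteq> UNIV \<Longrightarrow> G (add_ball l c) = G c"
    and K: "\<And>l. l \<in> I \<Longrightarrow> K l = UNIV" "\<And>l. gap_free (K l)"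
  shows "wsum V p Q (\<lambda>c. F c * (G c * meets V K c)) * wsum V p Q (meets V K)
    \<le> wsum V p Q (\<lambda>c. F c * meets V K c) * wsum V p Q (\<lambda>c. G c * meets V K c)"
  using p
proof (induction "card {i \<in> Q. (\<exists>l\<in>I. p i l \<noteq> 0) \<and> (\<exists>l\<in>V - I. p i l \<noteq> 0)}" arbitrary: p rule: less_induct)
  case less
  note p = less.prems
  define und where "und = (\<lambda>p. {i \<in> Q. (\<exists>l\<in>I. p i l \<noteq> (0::real)) \<and> (\<exists>l\<in>V - I. p i l \<noteq> 0)})"
  show ?case
  proof (cases "und p = {}")
    case True
    have free: "meets V K (add_ball l c) = meets V K c" if "l \<in> I" for l c
      using that K by (simp add: meets_add_ball_free)
    have "wsum V p Q (\<lambda>c. F c * (G c * meets V K c)) * wsum V p Q (\<lambda>c. 1 * meets V K c)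
      = wsum V p Q (\<lambda>c. F c * meets V K c) * wsum V p Q (\<lambda>c. 1 * (G c * meets V K c))"
      by (rule wsum_factorizes[OF V(1) Q V(2)]) (use True F G free in \<open>auto simp: und_def\<close>)
    thus ?thesis by simp
  next
    case False
    then obtain l0 where "l0 \<in> I" by (auto simp: und_def)
    interpret F: increasing_observable V I F
      using V F \<open>l0 \<in> I\<close> by unfold_locales auto
    \<comment> \<open>For \<open>G\<close>, all unconstrained bins play the part of \<open>I\<close>: this set contains \<open>I\<close> and is thus
      nonempty, whereas the set of bins that influence \<open>G\<close> may be empty.\<close>
    interpret G: increasing_observable V "{l \<in> V. K l = UNIV}" G
      using V G K \<open>l0 \<in> I\<close> by unfold_locales auto
    have admF: "F.admissible K" and admG: "G.admissible K"
      using K by (auto simp: F.admissible_def G.admissible_def)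
    let ?f = "\<lambda>c. F c * meets V K c" and ?g = "\<lambda>c. G c * meets V K c"
      and ?fg = "\<lambda>c. F c * (G c * meets V K c)" and ?k = "meets V K"
    let ?W = "wsum V p Q" and ?Win = "\<lambda>i. wsum V (restrict_ball p i I) Q"
      and ?Wout = "\<lambda>i. wsum V (restrict_ball p i (V - I)) Q"
    \<comment> \<open>\<open>D i\<close> is the unnormalized covariance of \<open>F\<close> with the event that ball \<open>i\<close> lands in \<open>I\<close>.\<close>
    define D where "D = (\<lambda>i. ?Win i ?f * ?W ?k - ?W ?f * ?Win i ?k)"
    have split: "?W h = ?Win i h + ?Wout i h" if "i \<in> Q" for i h
      by (rule wsum_split_ball[OF V(1) Q that V(2)])
    have "0 \<le> (\<Sum>t\<in>V - I. ?W ?f * ?W (\<lambda>c. real (c t) * ?k c) - ?W (\<lambda>c. real (c t) * ?f c) * ?W ?k)"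
      using F.load_covariance_nonpos[OF p Q admF] by (intro sum_nonneg) simp
    also have "\<dots> = (\<Sum>i\<in>Q. D i)"
      unfolding D_def sum_subtractf sum_distrib_left[symmetric] sum_distrib_right[symmetric]
        sum_wsum_restrict_ball[OF V(1) Q V(2)] by algebra
    also have "\<dots> = (\<Sum>i\<in>und p. D i)"
    proof (intro sum.mono_neutral_right ballI Q)
      fix i assume "i \<in> Q - und p"
      hence i: "i \<in> Q" and "(\<forall>l\<in>I. p i l = 0) \<or> (\<forall>l\<in>V - I. p i l = 0)"
        by (auto simp: und_def)
      hence "(\<forall>h. ?Win i h = 0) \<or> (\<forall>h. ?Wout i h = 0)"
        using V Q by (auto simp: wsum_restrict_ball)
      thus "D i = 0" unfolding D_def split[OF i] by auto
    qed (auto simp: und_def)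
    finally have "0 \<le> (\<Sum>i\<in>und p. D i)" .
    moreover have "finite (und p)" using Q by (simp add: und_def)
    ultimately obtain i where i: "i \<in> und p" "0 \<le> D i"
      using sum_strict_mono[of "und p" D "\<lambda>_. 0"] False by (force simp: not_le[symmetric])
    hence iQ: "i \<in> Q" by (simp add: und_def)
    have nonneg: "0 \<le> restrict_ball p i S j l" if "l \<in> V" for S j l
      using p that by (simp add: restrict_ball_def)
    have fewer: "card (und (restrict_ball p i S)) < card (und p)" if "S = I \<or> S = V - I" for S
    proof (intro psubset_card_mono \<open>finite (und p)\<close> psubsetI)
      show "und (restrict_ball p i S) \<subseteq> und p" by (auto simp: und_def restrict_ball_def split: if_splits)
      have "i \<notin> und (restrict_ball p i S)" using that by (auto simp: und_def restrict_ball_def)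
      thus "und (restrict_ball p i S) \<noteq> und p" using i by auto
    qed
    have IH: "wsum V (restrict_ball p i S) Q ?fg * wsum V (restrict_ball p i S) Q ?k
       \<le> wsum V (restrict_ball p i S) Q ?f * wsum V (restrict_ball p i S) Q ?g" if "S = I \<or> S = V - I" for S
      using less.hyps[OF fewer[OF that, unfolded und_def] nonneg] by simp
    have k0: "0 \<le> meets V K c" for c by (rule meets_nonneg)
    have fg0: "0 \<le> ?fg c" "?fg c \<le> ?k c" for c
      using F(1,2)[of c] G(1,2)[of c] k0[of c] 
      by (auto intro!: mult_left_le_one_le simp: mult.assoc[symmetric] mult_le_one)
    \<comment> \<open>Landing in \<open>I\<close> removes ball \<open>i\<close> as far as \<open>G\<close> and the constraint are concerned; landing
      outside \<open>I\<close> adds it, with restricted weights, to the remaining balls.\<close>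
    have g: "?Win i ?g * ?Wout i ?k \<le> ?Wout i ?g * ?Win i ?k"
    proof -
      have "restrict_ball p i (V - I) j = p j" if "j \<noteq> i" for j using that by (simp add: restrict_ball_def)
      hence same: "wsum V (restrict_ball p i (V - I)) (Q - {i}) h = wsum V p (Q - {i}) h" for h
        by (intro wsum_cong_weights) simp
      have "?Win i h = (\<Sum>l\<in>I. p i l) * wsum V p (Q - {i}) h" 
        if "\<And>l c. l \<in> I \<Longrightarrow> h (add_ball l c) = h c" for h
        using that by (simp add: wsum_restrict_ball[OF V(1) Q iQ V(2)] sum_distrib_right)
      hence W1: "?Win i ?g = (\<Sum>l\<in>I. p i l) * wsum V p (Q - {i}) ?g"
          "?Win i ?k = (\<Sum>l\<in>I. p i l) * wsum V p (Q - {i}) ?k"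
        using G(4) K by (simp_all add: meets_add_ball_free)
      have "(\<Sum>l\<in>I. p i l) * (wsum V p (Q - {i}) ?g * ?Wout i ?k) \<le> (\<Sum>l\<in>I. p i l) * (?Wout i ?g * wsum V p (Q - {i}) ?k)"
        using G.likelier_with_more_balls[where p = "restrict_ball p i (V - I)", OF nonneg Q iQ admG, unfolded same] p V
        by (intro mult_left_mono sum_nonneg) auto
      thus ?thesis unfolding W1 by (simp add: mult_ac)
    qed
    have f: "?Wout i ?f * ?Win i ?k \<le> ?Win i ?f * ?Wout i ?k"
      using i(2) unfolding D_def split[OF iQ] by (simp add: algebra_simps)
    show ?thesis unfolding split[OF iQ]
      by (rule mixture_negative_correlation[OF _ _ _ _ _ _ _ _ IH IH f g])
        (auto intro!: wsum_nonneg wsum_mono nonneg fg0 mult_nonneg_nonneg k0 F(1) G(1))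
  qed
qed

section \<open>The law of the occupancies\<close>

lemma loads_restrict: "loads Q (restrict s Q) = loads Q s"
  unfolding loads_def by (intro ext arg_cong[where f = card]) auto

lemma prob_loads:
  fixes \<sigma> :: "'i \<Rightarrow> 'a \<Rightarrow> 'b"
  assumes "prob_space M" "finite V" "finite Q" "Q \<noteq> {}"
    and indep: "prob_space.indep_vars M (\<lambda>_. count_space V) \<sigma> Q"
  shows "{\<omega> \<in> space M. P (loads Q (\<lambda>i. \<sigma> i \<omega>))} \<in> sets M"
    and "measure M {\<omega> \<in> space M. P (loads Q (\<lambda>i. \<sigma> i \<omega>))}
      = wsum V (\<lambda>i l. measure M {\<omega> \<in> space M. \<sigma> i \<omega> = l}) Q (\<lambda>c. of_bool (P c))"
proof -
  interpret prob_space M by fact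
  define ev where "ev = (\<lambda>s. \<Inter>i\<in>Q. \<sigma> i -` {s i} \<inter> space M)"
  define T where "T = {s \<in> Q \<rightarrow>\<^sub>E V. P (loads Q s)}"
  have mem_ev: "\<omega> \<in> ev s \<longleftrightarrow> \<omega> \<in> space M \<and> (\<forall>i\<in>Q. \<sigma> i \<omega> = s i)" for \<omega> s
    unfolding ev_def using assms(4) by blast
  have meas: "\<sigma> i \<in> measurable M (count_space V)" if "i \<in> Q" for i
    using indep that by (simp add: indep_vars_def)
  have T: "finite T"
    using finite_PiE[OF assms(3), of "\<lambda>_. V"] assms(2) by (simp add: T_def)
  have ev: "ev s \<in> sets M" "measure M (ev s) = (\<Prod>i\<in>Q. measure M {\<omega> \<in> space M. \<sigma> i \<omega> = s i})"
    if "s \<in> Q \<rightarrow>\<^sub>E V" for s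
  proof -
    have s: "s i \<in> V" if "i \<in> Q" for i using \<open>s \<in> Q \<rightarrow>\<^sub>E V\<close> that by (auto simp: PiE_iff)
    show "ev s \<in> sets M"
      unfolding ev_def using assms(3,4) s by (intro sets.finite_INT measurable_sets[OF meas]) auto
    have "measure M (ev s) = (\<Prod>i\<in>Q. measure M (\<sigma> i -` {s i} \<inter> space M))"
      unfolding ev_def using assms(3,4) s by (intro indep_varsD[OF indep]) auto
    also have "\<dots> = (\<Prod>i\<in>Q. measure M {\<omega> \<in> space M. \<sigma> i \<omega> = s i})"
      by (intro prod.cong refl arg_cong[where f = "measure M"]) auto
    finally show "measure M (ev s) = \<dots>" .
  qed
  have eq: "{\<omega> \<in> space M. P (loads Q (\<lambda>i. \<sigma> i \<omega>))} = (\<Union>s\<in>T. ev s)"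
  proof (intro equalityI subsetI)
    fix \<omega> assume \<omega>: "\<omega> \<in> {\<omega> \<in> space M. P (loads Q (\<lambda>i. \<sigma> i \<omega>))}"
    have "restrict (\<lambda>i. \<sigma> i \<omega>) Q \<in> T"
      using \<omega> measurable_space[OF meas] by (auto simp: T_def loads_restrict)
    moreover have "\<omega> \<in> ev (restrict (\<lambda>i. \<sigma> i \<omega>) Q)"
      using \<omega> by (simp add: mem_ev)
    ultimately show "\<omega> \<in> (\<Union>s\<in>T. ev s)" by blast
  next
    fix \<omega> assume "\<omega> \<in> (\<Union>s\<in>T. ev s)"
    then obtain s where s: "s \<in> T" "\<omega> \<in> ev s" by blast
    hence "loads Q (\<lambda>i. \<sigma> i \<omega>) = loads Q s"
      unfolding loads_def mem_ev by (intro ext arg_cong[where f = card]) auto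
    thus "\<omega> \<in> {\<omega> \<in> space M. P (loads Q (\<lambda>i. \<sigma> i \<omega>))}"
      using s by (simp add: T_def mem_ev)
  qed
  show "{\<omega> \<in> space M. P (loads Q (\<lambda>i. \<sigma> i \<omega>))} \<in> sets M"
    unfolding eq using T ev(1) by (intro sets.finite_UN) (auto simp: T_def)
  have "disjoint_family_on ev T"
    unfolding disjoint_family_on_def
  proof (intro ballI impI)
    fix s s' assume s: "s \<in> T" "s' \<in> T" "s \<noteq> s'"
    have "s = s'" if "\<omega> \<in> ev s" "\<omega> \<in> ev s'" for \<omega>
      using s that by (intro PiE_ext[of s Q "\<lambda>_. V"]) (auto simp: T_def mem_ev)
    thus "ev s \<inter> ev s' = {}" using s by blast
  qed
  hence "measure M (\<Union>s\<in>T. ev s) = (\<Sum>s\<in>T. measure M (ev s))"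
    using T ev(1) by (intro finite_measure_finite_Union) (auto simp: T_def)
  also have "\<dots> = (\<Sum>s\<in>Q \<rightarrow>\<^sub>E V. if P (loads Q s) then measure M (ev s) else 0)"
    unfolding T_def using assms by (intro sum.inter_filter finite_PiE) auto
  also have "\<dots> = wsum V (\<lambda>i l. measure M {\<omega> \<in> space M. \<sigma> i \<omega> = l}) Q (\<lambda>c. of_bool (P c))"
    unfolding wsum_def by (intro sum.cong) (auto simp: ev)
  finally show "measure M {\<omega> \<in> space M. P (loads Q (\<lambda>i. \<sigma> i \<omega>))}
      = wsum V (\<lambda>i l. measure M {\<omega> \<in> space M. \<sigma> i \<omega> = l}) Q (\<lambda>c. of_bool (P c))"
    unfolding eq .
qed

definition occupancy_vector :: "nat \<Rightarrow> (nat \<Rightarrow> nat) \<Rightarrow> nat \<Rightarrow> nat" where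
  "occupancy_vector n c = (\<lambda>j\<in>{1..n}. if c j \<ge> 1 then 1 else 0)"

lemma occupancy_vector_in_Nvec: "occupancy_vector n c \<in> Nvec n"
  by (simp add: occupancy_vector_def Nvec_def)

lemma not_affects_memD:
  assumes "\<not> affects n l A" "x \<in> A" "y \<in> Nvec n" "l \<in> {1..n}" "\<And>i. i \<in> {1..n} - {l} \<Longrightarrow> x i = y i"
  shows "y \<in> A"
  using assms unfolding affects_def by blast

context
  fixes M :: "'a measure" and m n :: nat and \<sigma> :: "nat \<Rightarrow> 'a \<Rightarrow> nat"
  assumes m: "0 < m" and M: "prob_space M"
    and indep: "prob_space.indep_vars M (\<lambda>_. count_space {1..n}) \<sigma> {1..m}"
begin

lemma occ_law_map_eq:
  "(\<lambda>\<omega>. \<lambda>j\<in>{1..n}. bin_occ m \<sigma> j \<omega>) = (\<lambda>\<omega>. occupancy_vector n (loads {1..m} (\<lambda>i. \<sigma> i \<omega>)))"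
  by (simp add: bin_occ_def bin_count_def loads_def occupancy_vector_def)

lemma measurable_occupancy:
  "(\<lambda>\<omega>. \<lambda>j\<in>{1..n}. bin_occ m \<sigma> j \<omega>) \<in> measurable M (count_space (Nvec n))"
proof (rule measurableI)
  fix X
  show "(\<lambda>\<omega>. \<lambda>j\<in>{1..n}. bin_occ m \<sigma> j \<omega>) -` X \<inter> space M \<in> sets M"
    using prob_loads(1)[OF M _ _ _ indep, of "\<lambda>c. occupancy_vector n c \<in> X"] m
    unfolding occ_law_map_eq vimage_def by (simp add: Int_def conj_commute)
qed (simp add: Nvec_def)

lemma measure_occ_law:
  assumes "X \<subseteq> Nvec n"
  shows "measure (occ_law M m n \<sigma>) X =
    wsum {1..n} (\<lambda>i l. measure M {\<omega> \<in> space M. \<sigma> i \<omega> = l}) {1..m} (\<lambda>c. of_bool (occupancy_vector n c \<in> X))"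
proof -
  have "measure (occ_law M m n \<sigma>) X = measure M ((\<lambda>\<omega>. \<lambda>j\<in>{1..n}. bin_occ m \<sigma> j \<omega>) -` X \<inter> space M)"
    unfolding occ_law_def using assms by (intro measure_distr measurable_occupancy) simp
  also have "\<dots> = measure M {\<omega> \<in> space M. occupancy_vector n (loads {1..m} (\<lambda>i. \<sigma> i \<omega>)) \<in> X}"
    unfolding occ_law_map_eq by (intro arg_cong[where f = "measure M"]) auto
  finally show ?thesis
    using prob_loads(2)[OF M _ _ _ indep, of "\<lambda>c. occupancy_vector n c \<in> X"] m by simp
qed

lemma prob_measure_occ_law: "prob_measure_on_Nvec n (occ_law M m n \<sigma>)"
  unfolding prob_measure_on_Nvec_def
  using prob_space.prob_space_distr[OF M measurable_occupancy] by (simp add: occ_law_def)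

text \<open>
  Negative correlation given \<open>E\<close>, with the normalization by the probability of \<open>E\<close> cleared.
\<close>

lemma occ_law_cylinder_negatively_associated:
  assumes a: "a \<in> Nvec n" and S: "S \<subseteq> {1..n}"
    and E: "E = {x \<in> Nvec n. \<forall>i\<in>S. x i = a i}"
    and A: "increasing_event n A" and B: "increasing_event n B" and AB: "perp_events n A B"
  shows "measure (occ_law M m n \<sigma>) (E \<inter> (A \<inter> B)) * measure (occ_law M m n \<sigma>) E
    \<le> measure (occ_law M m n \<sigma>) (E \<inter> A) * measure (occ_law M m n \<sigma>) (E \<inter> B)"
proof -
  define K where "K = (\<lambda>l. if l \<in> S then {d::nat. (if d \<ge> 1 then 1 else 0) = a l} else UNIV)"
  \<comment> \<open>Overwriting the coordinates in \<open>S\<close> by their prescribed values changes nothing on \<open>E\<close>. It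
    makes the indicators of \<open>A\<close> and \<open>B\<close> independent of the constrained bins, even of those that
    affect the events.\<close>
  define x where "x = (\<lambda>c. \<lambda>j\<in>{1..n}. if j \<in> S then a j else occupancy_vector n c j)"
  define ind where "ind = (\<lambda>X c. of_bool (x c \<in> X) :: real)"
  define I where "I = {l \<in> {1..n} - S. affects n l A}"
  let ?W = "wsum {1..n} (\<lambda>i l. measure M {\<omega> \<in> space M. \<sigma> i \<omega> = l}) {1..m}"
  have xN: "x c \<in> Nvec n" for c by (simp add: x_def Nvec_def)
  have E_iff: "occupancy_vector n c \<in> E \<longleftrightarrow> (\<forall>l\<in>{1..n}. c l \<in> K l)" for c
    using S by (auto simp: E occupancy_vector_in_Nvec K_def) (auto simp: occupancy_vector_def subset_iff)
  have x_eq: "x c = occupancy_vector n c" if "occupancy_vector n c \<in> E" for c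
    using that by (auto simp: x_def E occupancy_vector_def fun_eq_iff)
  have x_other: "x (add_ball l c) i = x c i" if "i \<noteq> l" for i l c
    using that by (simp add: x_def occupancy_vector_def add_ball_def)
  have x_fixed: "x (add_ball l c) = x c" if "l \<in> S" for l c
    using that by (auto simp: x_def occupancy_vector_def add_ball_def fun_eq_iff)
  have mono: "ind X c \<le> ind X (add_ball l c)" if "increasing_event n X" for X c l
  proof -
    have "x c i \<le> x (add_ball l c) i" if "i \<in> {1..n}" for i
      using that by (simp add: x_def occupancy_vector_def add_ball_def)
    hence "x c \<in> X \<Longrightarrow> x (add_ball l c) \<in> X"
      using that xN unfolding increasing_event_def by blast
    thus ?thesis by (simp add: ind_def)
  qed
  have indep: "ind X (add_ball l c) = ind X c" if "\<not> affects n l X" "l \<in> {1..n}" for X l c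
  proof -
    have "x (add_ball l c) \<in> X \<longleftrightarrow> x c \<in> X"
      using not_affects_memD[OF that(1) _ xN that(2)] x_other by (metis Diff_iff insertI1)
    thus ?thesis by (simp add: ind_def)
  qed
  have "?W (\<lambda>c. ind A c * (ind B c * meets {1..n} K c)) * ?W (meets {1..n} K)
      \<le> ?W (\<lambda>c. ind A c * meets {1..n} K c) * ?W (\<lambda>c. ind B c * meets {1..n} K c)"
  proof (rule wsum_negatively_associated[where I = I])
    show "ind A (add_ball l c) = ind A c" if "l \<in> {1..n} - I" for l c
      using that indep[of l A c] x_fixed[of l c] by (cases "l \<in> S") (auto simp: I_def ind_def)
    show "ind B (add_ball l c) = ind B c" if "l \<in> I" for l c
      using that AB by (intro indep) (auto simp: I_def perp_events_def)
    show "ind B (add_ball l c) = ind B c" if "K l \<noteq> UNIV" for l c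
      using that x_fixed[of l c] by (auto simp: K_def ind_def split: if_splits)
    show "gap_free (K l)" for l
      by (auto simp: K_def gap_free_def split: if_splits)
    show "ind A c \<le> ind A (add_ball l c)" "ind B c \<le> ind B (add_ball l c)" for c l
      using A B by (intro mono; simp)+
  qed (auto simp: I_def K_def ind_def)
  moreover have "measure (occ_law M m n \<sigma>) (E \<inter> X) = ?W (\<lambda>c. ind X c * meets {1..n} K c)" for X
  proof -
    have "of_bool (occupancy_vector n c \<in> E \<inter> X) = ind X c * meets {1..n} K c" for c
      using x_eq[of c] E_iff[of c] by (auto simp: ind_def meets_def)
    moreover have "E \<inter> X \<subseteq> Nvec n" by (auto simp: E)
    ultimately show ?thesis by (simp add: measure_occ_law)
  qed
  moreover have "ind (A \<inter> B) c * meets {1..n} K c = ind A c * (ind B c * meets {1..n} K c)" for c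
    by (auto simp: ind_def)
  moreover have "measure (occ_law M m n \<sigma>) E = ?W (meets {1..n} K)"
    using measure_occ_law[of E] by (simp add: E_iff meets_def[abs_def]) (simp add: E)
  ultimately show ?thesis by (simp only:)
qed

end

theorem theorem1p2:
  fixes M :: "'a measure" and m n :: nat and \<sigma> :: "nat \<Rightarrow> 'a \<Rightarrow> nat"
  assumes "0 < m" and "0 < n"
    and "prob_space M"
    and "prob_space.indep_vars M (\<lambda>_. count_space {1..n}) \<sigma> {1..m}"
  shows "conditionally_negatively_associated n (occ_law M m n \<sigma>)"
  unfolding conditionally_negatively_associated_def
proof (intro conjI ballI allI impI)
  let ?\<mu> = "occ_law M m n \<sigma>"
  show \<mu>: "prob_measure_on_Nvec n ?\<mu>"
    by (rule prob_measure_occ_law[OF assms(1,3,4)])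
  fix a S assume a: "a \<in> Nvec n" and S: "S \<subseteq> {1..n}"
  define E where "E = {x \<in> Nvec n. \<forall>i\<in>S. x i = a i}"
  assume "0 < measure ?\<mu> {x \<in> Nvec n. \<forall>i\<in>S. x i = a i}"
  hence pos: "0 < measure ?\<mu> E" by (simp add: E_def)
  interpret prob_space ?\<mu> using \<mu> by (simp add: prob_measure_on_Nvec_def)
  have sets: "sets ?\<mu> = Pow (Nvec n)" using \<mu> by (simp add: prob_measure_on_Nvec_def)
  have E: "E \<in> sets ?\<mu>" by (auto simp: sets E_def)
  have "emeasure ?\<mu> E \<noteq> 0" using pos by (simp add: emeasure_eq_measure)
  hence "prob_measure_on_Nvec n (uniform_measure ?\<mu> E)"
    unfolding prob_measure_on_Nvec_def by (auto intro!: prob_space_uniform_measure simp: sets)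
  moreover have "measure (uniform_measure ?\<mu> E) (A \<inter> B)
      \<le> measure (uniform_measure ?\<mu> E) A * measure (uniform_measure ?\<mu> E) B"
    if "increasing_event n A" "increasing_event n B" "perp_events n A B" for A B
  proof -
    have AB: "A \<in> sets ?\<mu>" "B \<in> sets ?\<mu>"
      using that by (auto simp: increasing_event_def sets)
    have cond: "measure (uniform_measure ?\<mu> E) X = measure ?\<mu> (E \<inter> X) / measure ?\<mu> E"
      if "X \<in> sets ?\<mu>" for X
      using pos that by (intro measure_uniform_measure) (auto simp: emeasure_eq_measure)
    show ?thesis
      using occ_law_cylinder_negatively_associated[OF assms(1,3,4) a S E_def that] pos AB
      by (simp add: cond field_simps)
  qed
  ultimately show "negatively_associated n (uniform_measure ?\<mu> {x \<in> Nvec n. \<forall>i\<in>S. x i = a i})"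
    unfolding negatively_associated_def E_def by blast
qed

end
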